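(* There is an absolute constant $C>0$ and an adaptive (possibly randomized) arm-pulling algorithm which, given inputs $n\ge 2$, $1\le K\le n-1$, $\epsilon\in(0,1]$ and $\delta\in(0,1/2]$, has the following guarantee for every instance with $n$ arms whose reward distributions are supported on $[0,1]$: with probability at least $1-\delta$, the algorithm outputs an $\epsilon$-top-$K$ set of arms and the total number of pulls it makes is at most $$C\left(\log\log\frac{4}{\Delta_t^{\epsilon}}+\log n+\log\frac1\delta\right)\sum_{i=1}^{n}\min\{\Delta_i^{-2},(\Delta_t^{\epsilon})^{-2}\},$$ where $t\in\{0,1,\dots,K-1\}$ is the largest integer satisfying $\Delta_{K-t}\cdot t\le K\epsilon$, and $\Delta_t^{\epsilon}=\max(\epsilon,\Delta_{K-t})$.
   Context: Stochastic $n$-armed bandit model: arm $i\in[n]$ has an unknown reward distribution $\mathcal D_i$ supported on $[0,1]$ with mean $\theta_i$; arms are indexed so that $\theta_1\ge\theta_2\ge\dots\ge\theta_n$ (this indexing is unknown to the algorithm). An algorithm sequentially and adaptively chooses an arm to pull; each pull of arm $i$ yields an independent sample from $\mathcal D_i$. The algorithm knows its input parameters but not the distributions, and at the end outputs a set of arms. For a set $T\subseteq[n]$ with $|T|=K$, the aggregate regret is $\mathcal R_T=\frac1K\left(\sum_{i=1}^K\theta_i-\sum_{i\in T}\theta_i\right)$; $T$ is an $\epsilon$-top-$K$ set if $|T|=K$ and $\mathcal R_T\le\epsilon$. Gaps: $\Delta_i=\theta_i-\theta_{K+1}$ if $i\le K$, and $\Delta_i=\theta_K-\theta_i$ if $i\ge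 K+1$ (with the convention $\Delta_i^{-2}=+\infty$ if $\Delta_i=0$). *)

theory Defs
  imports "HOL-Probability.Probability"
begin

datatype action = Pull nat | Stop "nat set"

text \<open>A (possibly randomized) adaptive algorithm: given its inputs n, K, epsilon, delta,
  an infinite tape of independent fair coin flips, and the history so far (list of
  (arm pulled, observed reward), oldest first), it decides its next action.\<close>
type_synonym algorithm =
  "nat \<Rightarrow> nat \<Rightarrow> real \<Rightarrow> real \<Rightarrow> (nat \<Rightarrow> bool) \<Rightarrow> (nat \<times> real) list \<Rightarrow> action"

definition pulls_of :: "nat \<Rightarrow> (nat \<times> real) list \<Rightarrow> nat" where
  "pulls_of i h = length (filter (\<lambda>p. fst p = i) h)"

text \<open>Execution with a reward tape: the j-th pull (0-based) of arm i returns w (i, j),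
  where the w (i, j) are independent and w (i, j) ~ D_i.  With fuel N, the result is
  Some S iff the algorithm stops after at most N pulls (all of valid arms i < n)
  and outputs S.\<close>
fun exec :: "((nat \<times> real) list \<Rightarrow> action) \<Rightarrow> nat \<Rightarrow> (nat \<times> nat \<Rightarrow> real)
             \<Rightarrow> nat \<Rightarrow> (nat \<times> real) list \<Rightarrow> nat set option" where
  "exec A n w 0 h = (case A h of Stop S \<Rightarrow> Some S | Pull i \<Rightarrow> None)"
| "exec A n w (Suc m) h = (case A h of Stop S \<Rightarrow> Some S
      | Pull i \<Rightarrow> (if i < n then exec A n w m (h @ [(i, w (i, pulls_of i h))]) else None))"

definition mean :: "real measure \<Rightarrow> real" where
  "mean M = (\<integral>x. x \<partial>M)"

text \<open>Gaps, in terms of the sorted means th_s 1 \<ge> th_s 2 \<ge> ... (1-indexed ranks).\<close>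
definition gap :: "(nat \<Rightarrow> real) \<Rightarrow> nat \<Rightarrow> nat \<Rightarrow> real" where
  "gap ths K i = (if i \<le> K then ths i - ths (K + 1) else ths K - ths i)"

definition agg_regret :: "(nat \<Rightarrow> real) \<Rightarrow> (nat \<Rightarrow> real) \<Rightarrow> nat \<Rightarrow> nat set \<Rightarrow> real" where
  "agg_regret ths th K T = ((\<Sum>i=1..K. ths i) - (\<Sum>i\<in>T. th i)) / real K"

definition eps_topK :: "nat \<Rightarrow> (nat \<Rightarrow> real) \<Rightarrow> (nat \<Rightarrow> real) \<Rightarrow> nat \<Rightarrow> real \<Rightarrow> nat set \<Rightarrow> bool" where
  "eps_topK n ths th K \<epsilon> T \<longleftrightarrow> T \<subseteq> {..<n} \<and> card T = K \<and> agg_regret ths th K T \<le> \<epsilon>"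

definition t_star :: "(nat \<Rightarrow> real) \<Rightarrow> nat \<Rightarrow> real \<Rightarrow> nat" where
  "t_star ths K \<epsilon> = (GREATEST t. t < K \<and> gap ths K (K - t) * real t \<le> real K * \<epsilon>)"

definition Delta_eps :: "(nat \<Rightarrow> real) \<Rightarrow> nat \<Rightarrow> real \<Rightarrow> real" where
  "Delta_eps ths K \<epsilon> = max \<epsilon> (gap ths K (K - t_star ths K \<epsilon>))"

text \<open>min{x^-2, d^-2} with the convention x^-2 = +infinity when x = 0.\<close>
definition min_inv_sq :: "real \<Rightarrow> real \<Rightarrow> real" where
  "min_inv_sq x d = (if x = 0 then 1 / d\<^sup>2 else min (1 / x\<^sup>2) (1 / d\<^sup>2))"

definition pull_bound :: "real \<Rightarrow> nat \<Rightarrow> (nat \<Rightarrow> real) \<Rightarrow> nat \<Rightarrow> real \<Rightarrow> real \<Rightarrow> real" where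
  "pull_bound C n ths K \<epsilon> \<delta> =
     C * (ln (ln (4 / Delta_eps ths K \<epsilon>)) + ln (real n) + ln (1 / \<delta>)) *
     (\<Sum>i=1..n. min_inv_sq (gap ths K i) (Delta_eps ths K \<epsilon>))"

definition coin_space :: "(nat \<Rightarrow> bool) measure" where
  "coin_space = (\<Pi>\<^sub>M j\<in>UNIV. measure_pmf (bernoulli_pmf (1/2)))"

definition reward_space :: "nat \<Rightarrow> (nat \<Rightarrow> real measure) \<Rightarrow> (nat \<times> nat \<Rightarrow> real) measure" where
  "reward_space n D = (\<Pi>\<^sub>M ij\<in>UNIV. (if fst ij < n then D (fst ij) else return borel 0))"

definition run_space :: "nat \<Rightarrow> (nat \<Rightarrow> real measure) \<Rightarrow> ((nat \<Rightarrow> bool) \<times> (nat \<times> nat \<Rightarrow> real)) measure" where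
  "run_space n D = coin_space \<Otimes>\<^sub>M reward_space n D"

end

theory Submission
  imports Defs
begin

text \<open>
  The algorithm works in phases. In phase \<open>r\<close> every active arm is sampled until its mean is known
  up to \<open>b = (1/2)^r\<close>; an arm is then accepted (rejected) once its estimate leaves no doubt that it
  belongs (does not belong) to the top \<open>K\<close>, so an arm that stays active has gap at most \<open>4 * b\<close>.
  If \<open>a\<close> of the \<open>K\<close> slots are still open, filling them with the empirically best active arms costs a
  total regret of at most \<open>2 * a * b\<close>, so the algorithm stops as soon as \<open>2 * a * b \<le> K * \<epsilon>\<close>.
  Once \<open>16 * b \<le> \<Delta>\<^sub>t\<^sup>\<epsilon>\<close> this must happen: if \<open>\<Delta>\<^sub>t\<^sup>\<epsilon> = \<epsilon>\<close> because \<open>a \<le> K\<close>, and otherwise because the top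
  \<open>K - t\<close> arms have been accepted, so that \<open>a \<le> t\<close> and \<open>\<Delta>\<^sub>K\<^sub>-\<^sub>t * t \<le> K * \<epsilon>\<close>. Hence an arm is sampled only to
  precision of order \<open>max \<Delta>\<^sub>i \<Delta>\<^sub>t\<^sup>\<epsilon>\<close>. Hoeffding's inequality and a union bound with weights
  \<open>1 / ((r + 1) * (r + 2))\<close> over the phases make all estimates accurate with probability \<open>1 - \<delta>\<close>;
  the weights are what produces the \<open>ln (ln (4 / \<Delta>\<^sub>t\<^sup>\<epsilon>))\<close> term.
\<close>

section \<open>The phase algorithm\<close>

text \<open>Both tests count arms instead of sorting them, so ties need no care; an arm counts
  itself in the first test and never in the second. The estimates \<open>e\<close> are a parameter
  so that one recursion serves both the full tape and what a history reveals of it.\<close>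

fun phase_state :: "nat \<Rightarrow> nat \<Rightarrow> (nat \<Rightarrow> nat \<Rightarrow> real) \<Rightarrow> nat \<Rightarrow> nat set \<times> nat set" where
  "phase_state n K e 0 = ({}, {..<n})"
| "phase_state n K e (Suc r) =
    (let (A, U) = phase_state n K e r;
         acc = {i\<in>U. card {j\<in>U. e r i - 2 * (1/2)^r \<le> e r j} \<le> K - card A};
         rej = {i\<in>U. K - card A \<le> card {j\<in>U. e r i + 2 * (1/2)^r < e r j}}
     in (A \<union> acc, U - acc - rej))"

definition accepted :: "nat \<Rightarrow> nat \<Rightarrow> (nat \<Rightarrow> nat \<Rightarrow> real) \<Rightarrow> nat \<Rightarrow> nat set" where
  "accepted n K e r = fst (phase_state n K e r)"

definition active :: "nat \<Rightarrow> nat \<Rightarrow> (nat \<Rightarrow> nat \<Rightarrow> real) \<Rightarrow> nat \<Rightarrow> nat set" where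
  "active n K e r = snd (phase_state n K e r)"

definition open_slots :: "nat \<Rightarrow> nat \<Rightarrow> (nat \<Rightarrow> nat \<Rightarrow> real) \<Rightarrow> nat \<Rightarrow> nat" where
  "open_slots n K e r = K - card (accepted n K e r)"

definition final_phase :: "nat \<Rightarrow> nat \<Rightarrow> real \<Rightarrow> (nat \<Rightarrow> nat \<Rightarrow> real) \<Rightarrow> nat \<Rightarrow> bool" where
  "final_phase n K \<epsilon> e r \<longleftrightarrow> 2 * (1/2)^r * real (open_slots n K e r) \<le> real K * \<epsilon>"

definition best_subset :: "(nat \<Rightarrow> real) \<Rightarrow> nat \<Rightarrow> nat set \<Rightarrow> nat set" where
  "best_subset f a U = (SOME B. B \<subseteq> U \<and> card B = a \<and>
     (\<forall>B'. B' \<subseteq> U \<and> card B' = a \<longrightarrow> sum f B' \<le> sum f B))"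

definition selection :: "nat \<Rightarrow> nat \<Rightarrow> (nat \<Rightarrow> nat \<Rightarrow> real) \<Rightarrow> nat \<Rightarrow> nat set" where
  "selection n K e r =
     accepted n K e r \<union> best_subset (e r) (open_slots n K e r) (active n K e r)"

definition estimate :: "(nat \<Rightarrow> nat) \<Rightarrow> (nat \<times> nat \<Rightarrow> real) \<Rightarrow> nat \<Rightarrow> nat \<Rightarrow> real" where
  "estimate m w r i = (\<Sum>j<m r. w (i, j)) / real (m r)"

text \<open>The reward tape revealed by a history; entries beyond the observed pulls are junk
  and do not affect the action that is taken.\<close>

definition history_tape :: "(nat \<times> real) list \<Rightarrow> nat \<times> nat \<Rightarrow> real" where
  "history_tape h = (\<lambda>(i, j). map snd (filter (\<lambda>p. fst p = i) h) ! j)"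

text \<open>No state is carried: the phases are recomputed from the whole history. Phase
  \<open>r\<close> averages the first \<open>m r\<close> rewards of an arm, so earlier samples are
  reused. Even in a final phase missing samples are drawn before stopping, because
  \<open>selection\<close> reads the estimates of that phase.\<close>

definition phase_algorithm ::
    "(nat \<Rightarrow> nat) \<Rightarrow> nat \<Rightarrow> nat \<Rightarrow> real \<Rightarrow> (nat \<times> real) list \<Rightarrow> action" where
  "phase_algorithm m n K \<epsilon> h =
    (let e = estimate m (history_tape h);
         lacking = (\<lambda>r i. i \<in> active n K e r \<and> pulls_of i h < m r);
         r = (LEAST r. final_phase n K \<epsilon> e r \<or> (\<exists>i. lacking r i))
     in if \<exists>i. lacking r i then Pull (SOME i. lacking r i) else Stop (selection n K e r))"

text \<open>The logarithm \<open>L\<close> is chosen so that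
  \<open>2 * exp (- L) = \<delta> / (n * (r + 2)^2)\<close>, which bounds the failure probability of
  one arm in phase \<open>r\<close>; the factor \<open>4^r\<close> cancels the squared precision in
  Hoeffding's exponent.\<close>

definition budget :: "nat \<Rightarrow> real \<Rightarrow> nat \<Rightarrow> nat" where
  "budget n \<delta> r = nat \<lceil>4^r * ln (2 * real n * (real r + 2)\<^sup>2 / \<delta>)\<rceil>"

lemma accepted_0 [simp]: "accepted n K e 0 = {}"
  and active_0 [simp]: "active n K e 0 = {..<n}"
  by (simp_all add: accepted_def active_def)

lemma accepted_Suc:
  "accepted n K e (Suc r) = accepted n K e r \<union>
     {i\<in>active n K e r. card {j\<in>active n K e r. e r i - 2 * (1/2)^r \<le> e r j} \<le> open_slots n K e r}"
  by (simp add: accepted_def active_def open_slots_def Let_def split_beta)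

lemma active_Suc:
  "active n K e (Suc r) = active n K e r -
     {i\<in>active n K e r. card {j\<in>active n K e r. e r i - 2 * (1/2)^r \<le> e r j} \<le> open_slots n K e r} -
     {i\<in>active n K e r. open_slots n K e r \<le> card {j\<in>active n K e r. e r i + 2 * (1/2)^r < e r j}}"
  by (simp add: accepted_def active_def open_slots_def Let_def split_beta)

lemma active_subset: "active n K e r \<subseteq> {..<n}"
  by (induction r) (auto simp: active_Suc)

lemma finite_active [simp]: "finite (active n K e r)"
  by (rule finite_subset[OF active_subset]) simp

section \<open>Optimal subsets, and dependence of the phases on the estimates\<close>

lemma best_subset:
  assumes "finite U" "a \<le> card U"
  shows "best_subset f a U \<subseteq> U" "card (best_subset f a U) = a"
    "\<And>B. B \<subseteq> U \<Longrightarrow> card B = a \<Longrightarrow> sum f B \<le> sum f (best_subset f a U)"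
proof -
  let ?S = "{B. B \<subseteq> U \<and> card B = a}"
  have fin: "finite ?S" using assms(1) by simp
  have "?S \<noteq> {}" using obtain_subset_with_card_n[OF assms(2)] by (metis (mono_tags) empty_iff mem_Collect_eq)
  then have "Max (sum f ` ?S) \<in> sum f ` ?S" using fin by (intro Max_in) auto
  then obtain B where B: "B \<in> ?S" "sum f B = Max (sum f ` ?S)" by auto
  have "\<forall>B'. B' \<subseteq> U \<and> card B' = a \<longrightarrow> sum f B' \<le> sum f B"
    unfolding B(2) using fin by (intro allI impI Max_ge) auto
  with B(1) have "\<exists>B. B \<subseteq> U \<and> card B = a \<and> (\<forall>B'. B' \<subseteq> U \<and> card B' = a \<longrightarrow> sum f B' \<le> sum f B)"
    by blast
  from someI_ex[OF this, folded best_subset_def]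
  show "best_subset f a U \<subseteq> U" "card (best_subset f a U) = a"
    "\<And>B. B \<subseteq> U \<Longrightarrow> card B = a \<Longrightarrow> sum f B \<le> sum f (best_subset f a U)"
    by auto
qed

text \<open>The two predicates under \<open>SOME\<close> are equal as functions, hence so are the
  chosen sets, even when the maximiser is not unique.\<close>

lemma best_subset_cong:
  assumes "\<And>i. i \<in> U \<Longrightarrow> f i = g i"
  shows "best_subset f a U = best_subset g a U"
proof -
  have "sum f B = sum g B" if "B \<subseteq> U" for B
    using that assms by (intro sum.cong) auto
  then have "(\<lambda>B. B \<subseteq> U \<and> card B = a \<and> (\<forall>B'. B' \<subseteq> U \<and> card B' = a \<longrightarrow> sum f B' \<le> sum f B)) =
      (\<lambda>B. B \<subseteq> U \<and> card B = a \<and> (\<forall>B'. B' \<subseteq> U \<and> card B' = a \<longrightarrow> sum g B' \<le> sum g B))"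
    by (intro ext) auto
  then show ?thesis unfolding best_subset_def by (rule arg_cong)
qed

text \<open>A phase reads only the estimates of arms active in it. Agreement is asked for there
  alone, because an arm that has been decided is not sampled up to later budgets.\<close>

lemma phase_state_cong:
  assumes "\<And>s i. s < r \<Longrightarrow> i \<in> active n K e s \<Longrightarrow> e s i = e' s i"
  shows "phase_state n K e r = phase_state n K e' r"
  using assms
proof (induction r)
  case (Suc r)
  have eq: "phase_state n K e r = phase_state n K e' r"
    by (rule Suc.IH, rule Suc.prems) simp_all
  obtain A U where AU: "phase_state n K e r = (A, U)" by force
  have ag: "e r i = e' r i" if "i \<in> U" for i
    by (rule Suc.prems) (use AU that in \<open>simp_all add: active_def\<close>)
  have sets: "{j\<in>U. e r i - 2 * (1/2)^r \<le> e r j} = {j\<in>U. e' r i - 2 * (1/2)^r \<le> e' r j}"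
    "{j\<in>U. e r i + 2 * (1/2)^r < e r j} = {j\<in>U. e' r i + 2 * (1/2)^r < e' r j}" if "i \<in> U" for i
    using ag that by auto
  have "{i\<in>U. card {j\<in>U. e r i - 2 * (1/2)^r \<le> e r j} \<le> K - card A} =
      {i\<in>U. card {j\<in>U. e' r i - 2 * (1/2)^r \<le> e' r j} \<le> K - card A}"
    "{i\<in>U. K - card A \<le> card {j\<in>U. e r i + 2 * (1/2)^r < e r j}} =
      {i\<in>U. K - card A \<le> card {j\<in>U. e' r i + 2 * (1/2)^r < e' r j}}"
    by (rule Collect_cong, rule conj_cong[OF refl], simp only: sets)+
  then show ?case
    by (simp only: phase_state.simps eq[symmetric] AU Let_def prod.case)
qed simp

lemma phase_cong:
  assumes "\<And>s i. s < r \<Longrightarrow> i \<in> active n K e s \<Longrightarrow> e s i = e' s i"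
  shows "accepted n K e r = accepted n K e' r" "active n K e r = active n K e' r"
    "open_slots n K e r = open_slots n K e' r"
    "final_phase n K \<epsilon> e r \<longleftrightarrow> final_phase n K \<epsilon> e' r"
proof -
  have "phase_state n K e r = phase_state n K e' r"
    by (rule phase_state_cong) (rule assms)
  then show "accepted n K e r = accepted n K e' r" "active n K e r = active n K e' r"
    "open_slots n K e r = open_slots n K e' r"
    "final_phase n K \<epsilon> e r \<longleftrightarrow> final_phase n K \<epsilon> e' r"
    by (simp_all add: accepted_def active_def open_slots_def final_phase_def)
qed

section \<open>Execution along a fixed reward tape\<close>

definition consistent :: "(nat \<times> nat \<Rightarrow> real) \<Rightarrow> (nat \<times> real) list \<Rightarrow> bool" where
  "consistent w h \<longleftrightarrow> (\<forall>i j. j < pulls_of i h \<longrightarrow> history_tape h (i, j) = w (i, j))"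

lemma consistent_Nil [simp]: "consistent w []"
  by (simp add: consistent_def pulls_of_def)

lemma pulls_of_Nil [simp]: "pulls_of i [] = 0"
  by (simp add: pulls_of_def)

lemma pulls_of_snoc: "pulls_of k (h @ [(i, x)]) = pulls_of k h + (if k = i then 1 else 0)"
  by (simp add: pulls_of_def)

lemma consistent_snoc:
  assumes "consistent w h"
  shows "consistent w (h @ [(i, w (i, pulls_of i h))])"
  using assms unfolding consistent_def
  by (auto simp: history_tape_def pulls_of_def nth_append less_Suc_eq)

lemma estimate_history:
  assumes "consistent w h" "m r \<le> pulls_of i h"
  shows "estimate m (history_tape h) r i = estimate m w r i"
  using assms by (auto simp: estimate_def consistent_def intro!: arg_cong2[where f="(/)"] sum.cong)

text \<open>The algorithm sees only its history, yet acts as if it ran the phases on the full tape: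
  all estimates used before the first phase that is final or lacks samples are already those of the
  tape.\<close>

lemma phase_algorithm_step:
  fixes m n K \<epsilon> w
  defines "e \<equiv> estimate m w"
  assumes h: "consistent w h"
    and R: "final_phase n K \<epsilon> e R" "\<And>r. r < R \<Longrightarrow> \<not> final_phase n K \<epsilon> e r"
  shows "phase_algorithm m n K \<epsilon> h = Stop (selection n K e R) \<or>
    (\<exists>i r. r \<le> R \<and> i \<in> active n K e r \<and> pulls_of i h < m r \<and> phase_algorithm m n K \<epsilon> h = Pull i)"
proof -
  define e' where "e' = estimate m (history_tape h)"
  define lack where "lack = (\<lambda>r i. i \<in> active n K e r \<and> pulls_of i h < m r)"
  define lack' where "lack' = (\<lambda>r i. i \<in> active n K e' r \<and> pulls_of i h < m r)"
  define r where "r = (LEAST r. final_phase n K \<epsilon> e r \<or> (\<exists>i. lack r i))"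
  have ex: "\<exists>r. final_phase n K \<epsilon> e r \<or> (\<exists>i. lack r i)" using R by blast
  have r: "final_phase n K \<epsilon> e r \<or> (\<exists>i. lack r i)"
    unfolding r_def using ex by (rule LeastI_ex)
  have before: "\<not> final_phase n K \<epsilon> e s" "\<not> lack s i" if "s < r" for s i
    using not_less_Least[OF that[unfolded r_def]] by blast+
  have rR: "r \<le> R" unfolding r_def using R by (intro Least_le) blast
  have agree: "e s i = e' s i" if "i \<in> active n K e s" "\<not> lack s i" for s i
    using that estimate_history[OF h, of m s i] by (auto simp: lack_def e_def e'_def)
  \<comment> \<open>The state at the start of phase \<open>s\<close> depends on earlier phases only,
    so agreement before \<open>r\<close> also covers the state at \<open>r\<close>, where samples
    may still be missing.\<close>
  have same: "active n K e s = active n K e' s"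
    "final_phase n K \<epsilon> e s \<longleftrightarrow> final_phase n K \<epsilon> e' s"
    "accepted n K e s = accepted n K e' s" "open_slots n K e s = open_slots n K e' s" if "s \<le> r" for s
  proof -
    have eq: "e u i = e' u i" if "u < s" "i \<in> active n K e u" for u i
      using that \<open>s \<le> r\<close> by (intro agree before) auto
    show "active n K e s = active n K e' s"
      "final_phase n K \<epsilon> e s \<longleftrightarrow> final_phase n K \<epsilon> e' s"
      "accepted n K e s = accepted n K e' s" "open_slots n K e s = open_slots n K e' s"
      by (rule phase_cong, erule (1) eq)+
  qed
  have lack_eq: "lack' s = lack s" if "s \<le> r" for s
    using same[OF that] by (simp add: lack_def lack'_def)
  have r': "(LEAST r. final_phase n K \<epsilon> e' r \<or> (\<exists>i. lack' r i)) = r"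
  proof (rule Least_equality)
    show "final_phase n K \<epsilon> e' r \<or> (\<exists>i. lack' r i)"
      using r same[of r] lack_eq[of r] by simp
    show "r \<le> s" if "final_phase n K \<epsilon> e' s \<or> (\<exists>i. lack' s i)" for s
    proof (rule ccontr)
      assume "\<not> r \<le> s"
      then have "s < r" by simp
      then show False using that before[of s] same(2)[of s] lack_eq[of s] by simp
    qed
  qed
  have alg: "phase_algorithm m n K \<epsilon> h =
    (if \<exists>i. lack r i then Pull (SOME i. lack r i) else Stop (selection n K e' r))"
    using r' lack_eq[of r] unfolding phase_algorithm_def Let_def e'_def[symmetric] lack'_def[symmetric]
    by (simp add: lack'_def)
  show ?thesis
  proof (cases "\<exists>i. lack r i")
    case True
    then have "lack r (SOME i. lack r i)" by (rule someI_ex)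
    with True show ?thesis using alg rR unfolding lack_def by auto
  next
    case False
    with r have "final_phase n K \<epsilon> e r" by blast
    with R(2) rR have [simp]: "r = R" by (metis nat_less_le)
    \<comment> \<open>With nothing lacking, the estimates of phase \<open>r\<close> itself agree as
      well.\<close>
    have "best_subset (e r) a (active n K e r) = best_subset (e' r) a (active n K e r)" for a
      using False agree by (intro best_subset_cong) blast
    then have "selection n K e' r = selection n K e r"
      using same[of r] by (simp add: selection_def)
    then show ?thesis using alg False by simp
  qed
qed

text \<open>\<open>B i\<close> caps the pulls of arm \<open>i\<close>. An arm is pulled only while
  it lacks samples, so the number of pulls left below the caps drops each time, and that much fuel
  is enough.\<close>

lemma exec_phase_algorithm:
  fixes m n K \<epsilon> w and B :: "nat \<Rightarrow> nat"
  defines "e \<equiv> estimate m w"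
  assumes R: "final_phase n K \<epsilon> e R" "\<And>r. r < R \<Longrightarrow> \<not> final_phase n K \<epsilon> e r"
    and B: "\<And>r i. r \<le> R \<Longrightarrow> i \<in> active n K e r \<Longrightarrow> m r \<le> B i"
    and "consistent w h" "(\<Sum>i<n. B i - pulls_of i h) \<le> N"
  shows "exec (phase_algorithm m n K \<epsilon>) n w N h = Some (selection n K e R)"
  using assms(5,6)
proof (induction N arbitrary: h)
  case (0 h)
  \<comment> \<open>Without fuel \<open>exec\<close> still returns the set of a \<open>Stop\<close>;
    since all caps are met, the action cannot be a pull.\<close>
  then have zero: "B i \<le> pulls_of i h" if "i < n" for i using that by auto
  have "\<not> (\<exists>i r. r \<le> R \<and> i \<in> active n K e r \<and> pulls_of i h < m r)"
    using zero B active_subset[of n K e] by (metis lessThan_iff le_trans not_le subsetD)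
  with phase_algorithm_step[OF 0(1) R[unfolded e_def]] show ?case by (auto simp: e_def)
next
  case (Suc N h)
  from phase_algorithm_step[OF Suc.prems(1) R[unfolded e_def], folded e_def]
  consider "phase_algorithm m n K \<epsilon> h = Stop (selection n K e R)"
    | i r where "r \<le> R" "i \<in> active n K e r" "pulls_of i h < m r" "phase_algorithm m n K \<epsilon> h = Pull i"
    by blast
  then show ?case
  proof cases
    case 2
    let ?h = "h @ [(i, w (i, pulls_of i h))]"
    have i: "i < n" using 2(2) active_subset[of n K e r] by auto
    have lt: "pulls_of i h < B i" using B[OF 2(1,2)] 2(3) by simp
    have "(\<Sum>k<n. B k - pulls_of k ?h) < (\<Sum>k<n. B k - pulls_of k h)"
      using i lt by (intro sum_strict_mono_ex1) (auto simp: pulls_of_snoc intro!: bexI[of _ i])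
    then have "exec (phase_algorithm m n K \<epsilon>) n w N ?h = Some (selection n K e R)"
      using Suc.prems by (intro Suc.IH consistent_snoc) auto
    then show ?thesis using 2(4) i by simp
  qed simp
qed

section \<open>Correctness under accurate estimates\<close>

locale sorted_arms =
  fixes n K :: nat and th :: "nat \<Rightarrow> real" and \<sigma> :: "nat \<Rightarrow> nat"
  assumes K: "1 \<le> K" "K < n"
    and bij: "bij_betw \<sigma> {1..n} {..<n}"
    and sorted: "\<And>i j. 1 \<le> i \<Longrightarrow> i \<le> j \<Longrightarrow> j \<le> n \<Longrightarrow> th (\<sigma> j) \<le> th (\<sigma> i)"
    and bounds: "\<And>i. i < n \<Longrightarrow> 0 \<le> th i \<and> th i \<le> 1"
begin

abbreviation ths :: "nat \<Rightarrow> real" where "ths k \<equiv> th (\<sigma> k)"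

definition Top :: "nat set" where "Top = \<sigma> ` {1..K}"

lemma \<sigma>_less: "1 \<le> k \<Longrightarrow> k \<le> n \<Longrightarrow> \<sigma> k < n"
  using bij_betwE[OF bij] by simp

lemma inj: "inj_on \<sigma> {1..n}"
  using bij by (simp add: bij_betw_def)

lemma \<sigma>_in_Top: "1 \<le> k \<Longrightarrow> k \<le> n \<Longrightarrow> \<sigma> k \<in> Top \<longleftrightarrow> k \<le> K"
  using inj_on_image_mem_iff[OF inj, of k "{1..K}"] K by (simp add: Top_def)

lemma rank_ex: "i < n \<Longrightarrow> \<exists>k. 1 \<le> k \<and> k \<le> n \<and> i = \<sigma> k"
  using bij_betw_imp_surj_on[OF bij] by (metis atLeastAtMost_iff imageE lessThan_iff)

lemma Top_subset: "Top \<subseteq> {..<n}"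
  using K \<sigma>_less by (auto simp: Top_def)

lemma finite_Top [simp]: "finite Top"
  by (simp add: Top_def)

lemma inj_Top: "inj_on \<sigma> {1..K}"
  using inj K by (auto intro: inj_on_subset)

lemma card_Top: "card Top = K"
  using inj_Top by (simp add: Top_def card_image)

lemma sum_Top: "sum f Top = (\<Sum>k=1..K. f (\<sigma> k))"
  using inj_Top by (simp add: Top_def sum.reindex)

lemma Top_ge: "i \<in> Top \<Longrightarrow> ths K \<le> th i"
  using K sorted by (auto simp: Top_def)

lemma not_Top_le: "i < n \<Longrightarrow> i \<notin> Top \<Longrightarrow> th i \<le> ths (K + 1)"
proof -
  assume "i < n" "i \<notin> Top"
  then obtain k where "1 \<le> k" "k \<le> n" "i = \<sigma> k" "\<not> k \<le> K"
    using rank_ex[of i] \<sigma>_in_Top by blast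
  then show ?thesis using sorted[of "K + 1" k] by simp
qed

lemma ths_Suc_K: "ths (K + 1) \<le> ths K"
  using K by (intro sorted) auto

lemma gap_bounds:
  assumes "1 \<le> k" "k \<le> n"
  shows "0 \<le> gap ths K k" "gap ths K k \<le> 1"
proof -
  have "0 \<le> ths (K + 1)" "ths K \<le> 1" "0 \<le> ths k" "ths k \<le> 1"
    using bounds[OF \<sigma>_less, of "K+1"] bounds[OF \<sigma>_less, of K] bounds[OF \<sigma>_less, of k] K assms
    by auto
  moreover have "ths (K + 1) \<le> ths k" if "k \<le> K" using that assms K by (intro sorted) auto
  moreover have "ths k \<le> ths K" if "\<not> k \<le> K" using that assms K by (intro sorted) auto
  ultimately show "0 \<le> gap ths K k" "gap ths K k \<le> 1" by (auto simp: gap_def)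
qed

text \<open>\<open>t = 0\<close> satisfies the condition and \<open>K\<close> bounds all candidates,
  so the greatest one exists.\<close>

lemma t_star:
  assumes "0 \<le> \<epsilon>"
  shows "t_star ths K \<epsilon> < K"
    "gap ths K (K - t_star ths K \<epsilon>) * real (t_star ths K \<epsilon>) \<le> real K * \<epsilon>"
proof -
  let ?P = "\<lambda>t. t < K \<and> gap ths K (K - t) * real t \<le> real K * \<epsilon>"
  have "?P 0" using assms K by simp
  then have "?P (GREATEST t. ?P t)" by (rule GreatestI_nat[where b = K]) auto
  then show "t_star ths K \<epsilon> < K"
    "gap ths K (K - t_star ths K \<epsilon>) * real (t_star ths K \<epsilon>) \<le> real K * \<epsilon>"
    unfolding t_star_def by blast+
qed

lemma Delta_eps_bounds:
  assumes "0 < \<epsilon>" "\<epsilon> \<le> 1"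
  shows "0 < Delta_eps ths K \<epsilon>" "Delta_eps ths K \<epsilon> \<le> 1"
proof -
  have "gap ths K (K - t_star ths K \<epsilon>) \<le> 1"
    using t_star(1)[of \<epsilon>] assms K by (intro gap_bounds) auto
  with assms show "0 < Delta_eps ths K \<epsilon>" "Delta_eps ths K \<epsilon> \<le> 1"
    by (auto simp: Delta_eps_def)
qed

end

text \<open>A finite horizon \<open>Q\<close> keeps the later union bound finite; it will be chosen
  so large that the run stops by phase \<open>Q\<close>.\<close>

locale accurate_estimates = sorted_arms +
  fixes e :: "nat \<Rightarrow> nat \<Rightarrow> real" and Q :: nat
  assumes accurate: "\<And>r i. r \<le> Q \<Longrightarrow> i < n \<Longrightarrow> \<bar>e r i - th i\<bar> \<le> (1/2)^r"
begin

abbreviation "U \<equiv> active n K e"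
abbreviation "A \<equiv> accepted n K e"
abbreviation "a \<equiv> open_slots n K e"

lemma U_less: "i \<in> U r \<Longrightarrow> i < n"
  using active_subset by blast

definition sound :: "nat \<Rightarrow> bool" where
  "sound r \<longleftrightarrow> A r \<subseteq> Top \<and> Top \<subseteq> A r \<union> U r \<and> A r \<inter> U r = {}"

text \<open>Under the invariant the open slots match the top arms still undecided, and the truncated
  subtraction in \<open>open_slots\<close> is a true one.\<close>

lemma open_slots_eq:
  assumes "sound r"
  shows "a r = card (U r \<inter> Top)" "K = card (A r) + a r"
proof -
  have fin: "finite (A r)" using assms finite_subset[OF _ finite_Top] by (auto simp: sound_def)
  have "Top = A r \<union> (U r \<inter> Top)" "A r \<inter> (U r \<inter> Top) = {}" using assms by (auto simp: sound_def)
  then have "K = card (A r) + card (U r \<inter> Top)"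
    using card_Un_disjoint[OF fin, of "U r \<inter> Top"] card_Top by simp
  then show "a r = card (U r \<inter> Top)" "K = card (A r) + a r" by (auto simp: open_slots_def)
qed

text \<open>If \<open>i\<close> were outside \<open>Top\<close>, every active top arm would be at
  least as good, and two errors of \<open>(1/2)^r\<close> would keep it within the margin. Together
  with \<open>i\<close> itself, \<open>a r + 1\<close> arms would pass the test.\<close>

lemma accept_sound:
  assumes r: "r \<le> Q" "sound r" and i: "i \<in> U r"
    and acc: "card {j\<in>U r. e r i - 2 * (1/2)^r \<le> e r j} \<le> a r"
  shows "i \<in> Top"
proof (rule ccontr)
  assume "i \<notin> Top"
  then have "insert i (U r \<inter> Top) \<subseteq> {j\<in>U r. e r i - 2 * (1/2)^r \<le> e r j}"
  proof (intro subsetI CollectI conjI)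
    fix j assume j: "j \<in> insert i (U r \<inter> Top)"
    then show jU: "j \<in> U r" using i by auto
    have "th i \<le> th j"
      using j not_Top_le[OF U_less[OF i] \<open>i \<notin> Top\<close>] Top_ge[of j] ths_Suc_K by auto
    then show "e r i - 2 * (1/2)^r \<le> e r j"
      using accurate[OF r(1) U_less[OF i]] accurate[OF r(1) U_less[OF jU]] by linarith
  qed
  then have "card (insert i (U r \<inter> Top)) \<le> card {j\<in>U r. e r i - 2 * (1/2)^r \<le> e r j}"
    by (intro card_mono) auto
  also note acc
  finally show False using \<open>i \<notin> Top\<close> open_slots_eq(1)[OF r(2)] by simp
qed

text \<open>An arm that looks better by more than two errors is truly better. If \<open>i\<close>
  were in \<open>Top\<close>, all such arms would be active top arms other than \<open>i\<close>,
  hence fewer than \<open>a r\<close>.\<close>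

lemma reject_sound:
  assumes r: "r \<le> Q" "sound r" and i: "i \<in> U r"
    and rej: "a r \<le> card {j\<in>U r. e r i + 2 * (1/2)^r < e r j}"
  shows "i \<notin> Top"
proof
  assume "i \<in> Top"
  have "j \<in> Top" if "j \<in> U r" "e r i + 2 * (1/2)^r < e r j" for j
  proof (rule ccontr)
    assume "j \<notin> Top"
    then have "th j \<le> th i"
      using not_Top_le[OF U_less[OF that(1)]] Top_ge[OF \<open>i \<in> Top\<close>] ths_Suc_K by simp
    then show False using accurate[OF r(1) U_less[OF i]] accurate[OF r(1) U_less[OF that(1)]] that(2)
      by linarith
  qed
  then have "{j\<in>U r. e r i + 2 * (1/2)^r < e r j} \<subseteq> U r \<inter> Top - {i}" by auto
  then have "card {j\<in>U r. e r i + 2 * (1/2)^r < e r j} \<le> card (U r \<inter> Top - {i})"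
    by (intro card_mono) auto
  also have "\<dots> < card (U r \<inter> Top)" using i \<open>i \<in> Top\<close> by (intro card_Diff1_less) auto
  finally show False using rej open_slots_eq(1)[OF r(2)] by simp
qed

lemma sound: "r \<le> Q \<Longrightarrow> sound r"
proof (induction r)
  case 0
  then show ?case using Top_subset by (simp add: sound_def)
next
  case (Suc r)
  then have r: "r \<le> Q" "sound r" by auto
  show ?case using accept_sound[OF r] reject_sound[OF r] r(2)
    unfolding sound_def accepted_Suc active_Suc by blast
qed

text \<open>The margin and two estimation errors add up to \<open>4 * (1/2)^r\<close>. Across a
  larger gap only top arms can rival a top arm, and all active top arms visibly beat any other arm,
  so phase \<open>r\<close> would have decided the arm.\<close>

lemma gap_active:
  assumes r: "Suc r \<le> Q" and k: "1 \<le> k" "k \<le> n" "\<sigma> k \<in> U (Suc r)"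
  shows "gap ths K k \<le> 4 * (1/2)^r"
proof (rule ccontr)
  assume gap: "\<not> gap ths K k \<le> 4 * (1/2)^r"
  have rQ: "r \<le> Q" using r by simp
  note slots = open_slots_eq(1)[OF sound[OF rQ]]
  have i: "\<sigma> k \<in> U r" using k by (auto simp: active_Suc)
  have acc: "\<bar>e r j - th j\<bar> \<le> (1/2)^r" if "j \<in> U r" for j
    using accurate[OF rQ U_less[OF that]] .
  show False
  proof (cases "k \<le> K")
    case True
    have "{j\<in>U r. e r (\<sigma> k) - 2 * (1/2)^r \<le> e r j} \<subseteq> U r \<inter> Top"
    proof
      fix j assume j: "j \<in> {j\<in>U r. e r (\<sigma> k) - 2 * (1/2)^r \<le> e r j}"
      then have "ths (K + 1) < th j"
        using acc[OF i] acc[of j] gap[unfolded gap_def] True by (simp add: abs_le_iff)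
      then show "j \<in> U r \<inter> Top" using j not_Top_le[of j] U_less[of j r] by force
    qed
    then have "card {j\<in>U r. e r (\<sigma> k) - 2 * (1/2)^r \<le> e r j} \<le> a r"
      unfolding slots by (intro card_mono) auto
    then show False using k(3) i by (simp add: active_Suc)
  next
    case False
    have "U r \<inter> Top \<subseteq> {j\<in>U r. e r (\<sigma> k) + 2 * (1/2)^r < e r j}"
    proof
      fix j assume j: "j \<in> U r \<inter> Top"
      then show "j \<in> {j\<in>U r. e r (\<sigma> k) + 2 * (1/2)^r < e r j}"
        using acc[OF i] acc[of j] gap[unfolded gap_def] False Top_ge[of j] by (simp add: abs_le_iff)
    qed
    then have "a r \<le> card {j\<in>U r. e r (\<sigma> k) + 2 * (1/2)^r < e r j}"
      unfolding slots by (intro card_mono) auto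
    then show False using k(3) i by (simp add: active_Suc)
  qed
qed

lemma final_phase_reached:
  assumes \<epsilon>: "0 < \<epsilon>" "\<epsilon> \<le> 1" and r: "r \<le> Q" and small: "16 * (1/2)^r \<le> Delta_eps ths K \<epsilon>"
  shows "final_phase n K \<epsilon> e r"
proof (cases "Delta_eps ths K \<epsilon> = \<epsilon>")
  case True
  have "2 * (1/2)^r * real (a r) \<le> \<epsilon> * real K"
    using small True \<epsilon> by (intro mult_mono) (auto simp: open_slots_def)
  then show ?thesis by (simp add: final_phase_def mult.commute)
next
  case False
  define t where "t = t_star ths K \<epsilon>"
  have D: "Delta_eps ths K \<epsilon> = gap ths K (K - t)" 
    using False by (simp add: Delta_eps_def t_def max_def split: if_splits)
  have t: "t < K" "gap ths K (K - t) * real t \<le> real K * \<epsilon>" using t_star[of \<epsilon>] \<epsilon> by (auto simp: t_def)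
  have "r \<noteq> 0" using small Delta_eps_bounds[OF \<epsilon>] by (intro notI) simp
  then obtain s where s: "r = Suc s" by (cases r) auto
  have "U r \<inter> Top \<subseteq> \<sigma> ` {K - t<..K}"
  proof
    fix i assume i: "i \<in> U r \<inter> Top"
    then obtain k where k: "1 \<le> k" "k \<le> K" "i = \<sigma> k" by (auto simp: Top_def)
    \<comment> \<open>Surviving phase \<open>s\<close> bounds the gap by
      \<open>4 * (1/2)^s = 8 * (1/2)^r\<close>. The strict inequality that follows places
      \<open>k\<close> behind rank \<open>K - t\<close> despite possible ties.\<close>
    have "gap ths K k \<le> 4 * (1/2)^s"
      using i k K r by (intro gap_active) (auto simp: s)
    also have "\<dots> < 16 * (1/2)^r" by (simp add: s)
    also have "\<dots> \<le> gap ths K (K - t)" using small D by simp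
    finally have "ths k < ths (K - t)" using k t by (simp add: gap_def)
    then have "K - t < k" using sorted[of k "K - t"] k t K by fastforce
    then show "i \<in> \<sigma> ` {K - t<..K}" using k by auto
  qed
  then have "card (U r \<inter> Top) \<le> card (\<sigma> ` {K - t<..K})" by (intro card_mono) auto
  also have "\<dots> \<le> card {K - t<..K}" by (intro card_image_le) auto
  also have "\<dots> \<le> t" by simp
  finally have at: "a r \<le> t" using open_slots_eq(1)[OF sound[OF r]] by simp
  have "2 * (1/2)^r * real (a r) \<le> gap ths K (K - t) * real t"
    using small D at by (intro mult_mono) (auto intro: order_trans[OF _ small[unfolded D]])
  then show ?thesis using t by (simp add: final_phase_def)
qed

text \<open>The accepted arms lie in \<open>Top\<close> and cancel. For the \<open>a r\<close>
  remaining slots, exchanging means for estimates costs \<open>(1/2)^r\<close> per arm, once for the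
  top arms and once for the chosen ones, and the choice maximises the estimated sum.\<close>

lemma selection_eps_topK:
  assumes r: "r \<le> Q" and fin: "final_phase n K \<epsilon> e r"
  shows "eps_topK n ths th K \<epsilon> (selection n K e r)"
proof -
  note s = sound[OF r]
  note slots = open_slots_eq[OF s]
  define B where "B = best_subset (e r) (a r) (U r)"
  have le: "a r \<le> card (U r)" unfolding slots(1) by (intro card_mono) auto
  have B: "B \<subseteq> U r" "card B = a r" "sum (e r) (U r \<inter> Top) \<le> sum (e r) B"
    unfolding B_def using best_subset[OF finite_active le] slots by auto
  have finB: "finite B" using B(1) by (rule finite_subset) simp
  have finA: "finite (A r)" using s finite_subset[OF _ finite_Top] by (auto simp: sound_def)
  have AB: "A r \<inter> B = {}" using s B by (auto simp: sound_def)
  have sel: "selection n K e r = A r \<union> B" by (simp add: selection_def B_def)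
  have card: "card (A r \<union> B) = K" using card_Un_disjoint[OF finA finB AB] slots B by simp
  have sub: "A r \<union> B \<subseteq> {..<n}" using s Top_subset B active_subset[of n K e r] by (auto simp: sound_def)
  have "Top = A r \<union> (U r \<inter> Top)" "A r \<inter> (U r \<inter> Top) = {}" using s by (auto simp: sound_def)
  then have sumTop: "sum th Top = sum th (A r) + sum th (U r \<inter> Top)"
    using sum.union_disjoint[OF finA, of "U r \<inter> Top" th] by simp
  have sumsel: "sum th (A r \<union> B) = sum th (A r) + sum th B"
    by (rule sum.union_disjoint[OF finA finB AB])
  have est: "\<bar>e r i - th i\<bar> \<le> (1/2)^r" if "i \<in> U r" for i using accurate[OF r U_less[OF that]] .
  have "sum th (U r \<inter> Top) \<le> (\<Sum>i\<in>U r \<inter> Top. e r i + (1/2)^r)"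
    using est by (intro sum_mono) (fastforce simp: abs_le_iff)
  also have "\<dots> = sum (e r) (U r \<inter> Top) + real (a r) * (1/2)^r" by (simp add: sum.distrib slots(1))
  also have "\<dots> \<le> sum (e r) B + real (a r) * (1/2)^r" using B by simp
  also have "\<dots> = (\<Sum>i\<in>B. e r i - (1/2)^r) + 2 * (1/2)^r * real (a r)"
    by (simp add: sum_subtractf B(2))
  also have "(\<Sum>i\<in>B. e r i - (1/2)^r) \<le> sum th B"
    using est B(1) by (intro sum_mono) (fastforce simp: abs_le_iff)
  finally have "sum th Top - sum th (A r \<union> B) \<le> real K * \<epsilon>"
    using fin sumTop sumsel by (simp add: final_phase_def)
  then have "agg_regret ths th K (A r \<union> B) \<le> \<epsilon>"
    using K by (simp add: agg_regret_def sum_Top field_simps)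
  then show ?thesis using sel card sub by (simp add: eps_topK_def)
qed

text \<open>An arm active in phase \<open>s + 1\<close> survived phase \<open>s\<close>, which
  bounds its gap, and phase \<open>s\<close> was not final, which bounds \<open>Delta_eps\<close>.
  In phase 0 both are at most 1.\<close>

lemma active_precision:
  assumes \<epsilon>: "0 < \<epsilon>" "\<epsilon> \<le> 1" and R: "R \<le> Q" "\<And>r. r < R \<Longrightarrow> \<not> final_phase n K \<epsilon> e r"
    and r: "r \<le> R" and k: "1 \<le> k" "k \<le> n" "\<sigma> k \<in> U r"
  shows "max (gap ths K k) (Delta_eps ths K \<epsilon>) \<le> 32 * (1/2)^r"
proof (cases r)
  case 0
  then show ?thesis using gap_bounds[OF k(1,2)] Delta_eps_bounds[OF \<epsilon>] by simp
next
  case (Suc s)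
  have "gap ths K k \<le> 4 * (1/2)^s" using k r R Suc by (intro gap_active) auto
  moreover have "Delta_eps ths K \<epsilon> < 16 * (1/2)^s"
    using final_phase_reached[OF \<epsilon>, of s] R(2)[of s] r R(1) Suc by fastforce
  ultimately show ?thesis 
    using zero_le_power[of "1/2::real" s] unfolding Suc power_Suc by (intro max.boundedI) linarith+
qed

end

section \<open>The sample budget against the pull bound\<close>

text \<open>With \<open>y = max x d\<close> the minimum of the inverse squares is
  \<open>1 / y^2\<close>. The constant is \<open>2 * 1024 * 8\<close>: rounding up,
  \<open>4^r\<close> against \<open>1 / y^2\<close>, and the logarithm against
  \<open>W\<close>.\<close>

lemma budget_le:
  fixes x d :: real
  assumes n: "2 \<le> n" and \<delta>: "0 < \<delta>" "\<delta> \<le> 1/2" and d: "0 < d" "d \<le> 1" and x: "0 \<le> x"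
    and prec: "max x d \<le> 32 * (1/2)^r"
  shows "real (budget n \<delta> r) \<le>
    16384 * (ln (ln (4 / d)) + ln (real n) + ln (1 / \<delta>)) * min_inv_sq x d"
proof -
  define L where "L = ln (2 * real n * (real r + 2)\<^sup>2 / \<delta>)"
  define W where "W = ln (ln (4 / d)) + ln (real n) + ln (1 / \<delta>)"
  define y where "y = max x d"
  have y: "0 < y" "y \<le> 32 * (1/2)^r" "d \<le> y" using d prec by (auto simp: y_def)
  have inv: "min_inv_sq x d = 1 / y\<^sup>2"
  proof (cases "x \<le> d")
    case True
    then have "y = d" by (simp add: y_def)
    moreover have "1 / d\<^sup>2 \<le> 1 / x\<^sup>2" if "x \<noteq> 0"
      using that True x by (intro divide_left_mono power_mono) auto
    ultimately show ?thesis by (auto simp: min_inv_sq_def min_def)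
  next
    case False
    then have "y = x" "x \<noteq> 0" using d by (auto simp: y_def)
    moreover have "1 / x\<^sup>2 \<le> 1 / d\<^sup>2"
      using False d by (intro divide_left_mono power_mono) auto
    ultimately show ?thesis by (auto simp: min_inv_sq_def min_def)
  qed
  have pow: "2^r \<le> 32 / y" using y by (simp add: power_one_over field_simps)
  have "(4::real)^r = (2^r)\<^sup>2" by (simp add: power2_eq_square flip: power_mult_distrib)
  also have "\<dots> \<le> (32 / y)\<^sup>2" using pow by (intro power_mono) auto
  finally have four: "4^r \<le> 1024 / y\<^sup>2" by (simp add: power_divide)
  have ln2: "1/2 \<le> ln (2::real)" "ln (2::real) \<le> 1" using ln2_ge_two_thirds ln_2_less_1 by auto
  have ln4: "ln (4::real) = 2 * ln 2" using ln_realpow[of 2 2] by simp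
  have ln8: "ln (8::real) = 3 * ln 2" using ln_realpow[of 2 3] by simp
  have ln4d: "ln (4 / d) \<ge> 2 * ln 2" using d by (simp add: ln_div ln4)
  \<comment> \<open>Since \<open>32 / d = 8 * (4 / d)\<close>, the phase number is at most of order
    \<open>ln (4 / d)\<close>, and \<open>ln (r + 2)\<close> yields the iterated logarithm.\<close>
  have "2^r \<le> 32 / d" using pow y d by (meson divide_left_mono frac_le order_trans zero_le_numeral order_refl)
  then have "ln (2^r) \<le> ln (32 / d)" using d by (subst ln_le_cancel_iff) auto
  also have "ln (32 / d) = ln (8 * (4 / d))" by simp
  also have "\<dots> = 3 * ln 2 + ln (4 / d)"
    using d ln_mult[of 8 "4 / d"] ln8 by (simp del: times_divide_eq_right)
  finally have "real r * ln 2 \<le> 3 * ln 2 + ln (4 / d)" by (simp add: ln_realpow)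
  then have "(real r + 2) * ln 2 \<le> 4 * ln (4 / d)" using ln4d ln2 by (simp add: algebra_simps)
  moreover have "(real r + 2) * (1/2) \<le> (real r + 2) * ln 2" using ln2 by (intro mult_left_mono) auto
  ultimately have "(real r + 2) * (1/2) \<le> 4 * ln (4 / d)" by (rule order_trans[rotated])
  then have "real r + 2 \<le> 8 * ln (4 / d)" by simp
  then have "ln (real r + 2) \<le> ln (8 * ln (4 / d))"
    by (intro ln_mono) auto
  also have "\<dots> = 3 * ln 2 + ln (ln (4 / d))"
    using ln4d ln2 ln_mult[of 8 "ln (4 / d)"] ln8 by simp
  finally have lnr: "ln (real r + 2) \<le> 3 * ln 2 + ln (ln (4 / d))" .
  have L: "L = ln 2 + ln (real n) + 2 * ln (real r + 2) + ln (1 / \<delta>)"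
    using n \<delta> by (simp add: L_def ln_mult ln_div ln_realpow)
  have lnn: "ln 2 \<le> ln (real n)" using n by (intro ln_mono) auto
  have ln\<delta>: "ln 2 \<le> ln (1 / \<delta>)" using \<delta> by (intro ln_mono) (auto simp: field_simps)
  have lnr0: "ln 2 \<le> ln (real r + 2)" by (intro ln_mono) auto
  have lnln: "0 \<le> ln (ln (4 / d))" using ln4d ln2 by (intro ln_ge_zero) auto
  have L1: "1 \<le> L" using L lnn ln\<delta> lnr0 ln2 by linarith
  \<comment> \<open>The leftover \<open>7 * ln 2\<close> is absorbed by
    \<open>7 * ln (real n)\<close>.\<close>
  have LW: "L \<le> 8 * W" using L lnr lnn ln\<delta> lnln ln2 unfolding W_def by argo
  have one: "1 \<le> (4::real)^r * L" using L1 mult_mono[of 1 "4^r" 1 L] by simp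
  have "real (budget n \<delta> r) = of_int \<lceil>4^r * L\<rceil>"
    using one by (simp add: budget_def L_def)
  also have "\<dots> \<le> 4^r * L + 1" by (rule of_int_ceiling_le_add_one)
  also have "\<dots> \<le> 2 * (4^r * L)" using one by argo
  also have "\<dots> \<le> 2 * (1024 / y\<^sup>2 * (8 * W))"
    using four LW L1 by (intro mult_left_mono mult_mono) auto
  finally show ?thesis by (simp add: inv W_def)
qed

section \<open>Concentration of the estimates\<close>

text \<open>Restricting the product measure to \<open>J\<close> gives the product of the factors,
  and this joint law characterises independence. The criterion asks for a nonempty index set, hence
  the separate case.\<close>

lemma indep_vars_coordinates:
  assumes M: "\<And>i. prob_space (M i)" "\<And>i. sets (M i) = sets N" and J: "finite J"
  shows "prob_space.indep_vars (PiM UNIV M) (\<lambda>_. N) (\<lambda>i \<omega>. \<omega> i) J"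
proof (cases "J = {}")
  case True
  interpret prob_space "PiM UNIV M" by (intro prob_space_PiM M)
  show ?thesis using True by (simp add: indep_vars_def indep_sets_def)
next
  case False
  interpret product_prob_space M UNIV
    using M by (simp add: product_prob_spaceI)
  have meas: "(\<lambda>\<omega>. \<omega> i) \<in> measurable (PiM UNIV M) N" for i
    using measurable_component_singleton[of i UNIV M] measurable_cong_sets[OF refl M(2)] by blast
  have comp: "distr (PiM UNIV M) N (\<lambda>\<omega>. \<omega> i) = M i" for i
    using PiM_component[of i] distr_cong[OF refl M(2)[of i] refl, of "PiM UNIV M" "\<lambda>\<omega>. \<omega> i"] by simp
  have "distr (PiM UNIV M) (PiM J (\<lambda>_. N)) (\<lambda>\<omega>. \<lambda>i\<in>J. \<omega> i) = distr (PiM UNIV M) (PiM J M) (\<lambda>\<omega>. restrict \<omega> J)"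
    using M(2) by (intro distr_cong refl sets_PiM_cong) (auto simp: restrict_def)
  also have "\<dots> = PiM J M" using J by (intro distr_PiM_restrict_finite) auto
  finally show ?thesis
    using False meas by (subst indep_vars_iff_distr_eq_PiM') (auto simp: comp)
qed

definition arm_measure :: "nat \<Rightarrow> (nat \<Rightarrow> real measure) \<Rightarrow> nat \<times> nat \<Rightarrow> real measure" where
  "arm_measure n D ij = (if fst ij < n then D (fst ij) else return borel 0)"

context
  fixes n :: nat and D :: "nat \<Rightarrow> real measure"
  assumes D: "\<And>i. i < n \<Longrightarrow> prob_space (D i)" "\<And>i. i < n \<Longrightarrow> sets (D i) = sets borel"
    "\<And>i. i < n \<Longrightarrow> AE x in D i. 0 \<le> x \<and> x \<le> 1"
begin

lemma prob_space_arm_measure: "prob_space (arm_measure n D ij)"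
  using D by (auto simp: arm_measure_def intro!: prob_space_return)

lemma sets_arm_measure: "sets (arm_measure n D ij) = sets borel"
  using D by (auto simp: arm_measure_def)

lemma reward_space_eq: "reward_space n D = PiM UNIV (arm_measure n D)"
  unfolding reward_space_def by (intro PiM_cong) (auto simp: arm_measure_def)

lemma prob_space_reward_space: "prob_space (reward_space n D)"
  unfolding reward_space_eq by (intro prob_space_PiM prob_space_arm_measure)

lemma measurable_reward [measurable]: "(\<lambda>w. w ij) \<in> borel_measurable (reward_space n D)"
  using measurable_component_singleton[of ij UNIV "arm_measure n D"]
    measurable_cong_sets[OF refl sets_arm_measure] unfolding reward_space_eq by blast

lemma mean_bounds:
  assumes "i < n"
  shows "0 \<le> mean (D i)" "mean (D i) \<le> 1"
proof -
  interpret prob_space "D i" using D assms by simp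
  have meas: "(\<lambda>x. x) \<in> borel_measurable (D i)" using D(2)[OF assms] by (simp add: measurable_ident_sets)
  have "integrable (D i) (\<lambda>x. x)"
    using D(3)[OF assms] meas by (intro integrable_const_bound[where B=1]) (auto elim: eventually_mono)
  then show "mean (D i) \<le> 1" unfolding mean_def
    using D(3)[OF assms] by (intro integral_le_const) (auto elim: eventually_mono)
  show "0 \<le> mean (D i)" unfolding mean_def
    using D(3)[OF assms] by (intro integral_nonneg_AE) (auto elim: eventually_mono)
qed

text \<open>The rewards at \<open>(i, j)\<close> for \<open>j < k\<close> are independent with law
  \<open>D i\<close> on the unit interval, so Hoeffding's inequality applies; coordinate
  \<open>(i, 0)\<close> represents the common law.\<close>

lemma sample_mean_deviation:
  assumes i: "i < n" and k: "k > 0" and b: "b \<ge> 0"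
  shows "measure (reward_space n D)
      {w\<in>space (reward_space n D). \<bar>(\<Sum>j<k. w (i, j)) / real k - mean (D i)\<bar> \<ge> b}
    \<le> 2 * exp (- 2 * real k * b\<^sup>2)"
proof -
  interpret prob_space "reward_space n D" by (rule prob_space_reward_space)
  have dist: "distr (reward_space n D) borel (\<lambda>w. w (i, j)) = D i" for j
  proof -
    have "distr (reward_space n D) borel (\<lambda>w. w (i, j)) =
        distr (PiM UNIV (arm_measure n D)) (arm_measure n D (i, j)) (\<lambda>w. w (i, j))"
      unfolding reward_space_eq by (intro distr_cong refl sets_arm_measure[symmetric])
    also have "\<dots> = arm_measure n D (i, j)"
      by (intro distr_PiM_component prob_space_arm_measure) auto
    finally show ?thesis using i by (simp add: arm_measure_def)
  qed
  have mean: "expectation (\<lambda>w. w (i, 0)) = mean (D i)"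
    unfolding mean_def dist[of 0, symmetric] by (subst integral_distr) auto
  interpret Hoeffding_ineq_iid "reward_space n D" "{i} \<times> {..<k}" "\<lambda>ij w. w ij" "\<lambda>w. w (i, 0)" 0 1 "mean (D i)"
  proof unfold_locales
    show "indep_vars (\<lambda>_. borel) (\<lambda>ij w. w ij) ({i} \<times> {..<k})"
      unfolding reward_space_eq
      by (intro indep_vars_coordinates prob_space_arm_measure sets_arm_measure) auto
    have "AE x in distr (reward_space n D) borel (\<lambda>w. w (i, 0)). x \<in> {0..1}"
      unfolding dist using D(3)[OF i] by (auto elim: eventually_mono)
    then show "AE w in reward_space n D. w (i, 0) \<in> {0..1}"
      by (subst (asm) AE_distr_iff) auto
  qed (auto simp: dist mean)
  have "(\<Sum>ij\<in>{i} \<times> {..<k}. w ij) = (\<Sum>j<k. w (i, j))" for w :: "nat \<times> nat \<Rightarrow> real"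
    by (intro sum.reindex_bij_witness[where i = "\<lambda>j. (i, j)" and j = snd]) auto
  then show ?thesis
    using Hoeffding_ineq_abs_ge'[OF b] k by (simp add: lessThan_empty_iff)
qed
text \<open>Each term is \<open>1 / (r + 1) - 1 / (r + 2)\<close>; the total weight stays below 1
  whatever the horizon.\<close>

lemma sum_reciprocal_telescope:
  "(\<Sum>r\<le>Q. 1 / ((real r + 1) * (real r + 2))) = 1 - 1 / (real Q + 2)"
proof (induction Q)
  case (Suc Q)
  show ?case unfolding sum.atMost_Suc Suc.IH
    by (simp add: divide_simps) (simp add: algebra_simps)
qed simp

lemma budget_pos:
  assumes "2 \<le> n" "0 < \<delta>" "\<delta> \<le> 1/2"
  shows "0 < budget n \<delta> r"
    "4^r * ln (2 * real n * (real r + 2)\<^sup>2 / \<delta>) \<le> real (budget n \<delta> r)"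
proof -
  have "1 * 1 * 1 < 2 * real n * (real r + 2)\<^sup>2"
    using assms by (intro mult_strict_mono one_less_power) auto
  also have "\<dots> \<le> 2 * real n * (real r + 2)\<^sup>2 / \<delta>"
    using assms by (simp add: field_simps mult_left_le)
  finally have pos: "0 < 4^r * ln (2 * real n * (real r + 2)\<^sup>2 / \<delta>)"
    by (intro mult_pos_pos ln_gt_zero) auto
  show le: "4^r * ln (2 * real n * (real r + 2)\<^sup>2 / \<delta>) \<le> real (budget n \<delta> r)"
    unfolding budget_def by (rule real_nat_ceiling_ge)
  show "0 < budget n \<delta> r"
    using less_le_trans[OF pos le] by simp
qed

lemma budget_deviation:
  assumes i: "i < n" and n: "2 \<le> n" and \<delta>: "0 < \<delta>" "\<delta> \<le> 1/2"
  shows "measure (reward_space n D)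
      {w\<in>space (reward_space n D). \<bar>estimate (budget n \<delta>) w r i - mean (D i)\<bar> \<ge> (1/2)^r}
    \<le> \<delta> / real n * (1 / ((real r + 1) * (real r + 2)))"
proof -
  let ?z = "2 * real n * (real r + 2)\<^sup>2 / \<delta>"
  have z: "0 < ?z" using n \<delta> by simp
  have quarter: "(4::real)^r * ((1/2)^r)\<^sup>2 = 1"
    by (simp add: power2_eq_square flip: power_mult_distrib)
  have "ln ?z = 4^r * ((1/2)^r)\<^sup>2 * ln ?z" by (simp only: quarter mult_1_left)
  also have "\<dots> = 4^r * ln ?z * ((1/2)^r)\<^sup>2" by (simp only: mult_ac)
  also have "\<dots> \<le> real (budget n \<delta> r) * ((1/2)^r)\<^sup>2"
    using budget_pos(2)[OF n \<delta>] by (rule mult_right_mono) simp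
  finally have L: "ln ?z \<le> real (budget n \<delta> r) * ((1/2)^r)\<^sup>2" .
  \<comment> \<open>The factor 2 in Hoeffding's exponent is given away here.\<close>
  have "u \<le> v \<Longrightarrow> 0 \<le> v \<Longrightarrow> - 2 * v \<le> - u" for u v :: real by linarith
  from this[OF L] have exponent: "- 2 * real (budget n \<delta> r) * ((1/2)^r)\<^sup>2 \<le> - ln ?z"
    by (simp only: mult.assoc) simp
  have "measure (reward_space n D)
      {w\<in>space (reward_space n D). \<bar>estimate (budget n \<delta>) w r i - mean (D i)\<bar> \<ge> (1/2)^r}
    \<le> 2 * exp (- 2 * real (budget n \<delta> r) * ((1/2)^r)\<^sup>2)"
    unfolding estimate_def by (intro sample_mean_deviation i budget_pos[OF n \<delta>]) auto
  also have "\<dots> \<le> 2 * exp (- ln ?z)"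
    using exponent by simp
  also have "\<dots> = \<delta> / real n * (1 / (real r + 2)\<^sup>2)"
    using z n \<delta> by (simp add: exp_minus)
  also have "\<dots> \<le> \<delta> / real n * (1 / ((real r + 1) * (real r + 2)))"
    using n \<delta> by (intro mult_left_mono divide_left_mono) (auto simp: power2_eq_square)
  finally show ?thesis .
qed

text \<open>In the union bound the shares \<open>\<delta> / n\<close> add up to
  \<open>\<delta>\<close> over the arms, and the phase weights to less than 1.\<close>

lemma prob_accurate:
  assumes n: "2 \<le> n" and \<delta>: "0 < \<delta>" "\<delta> \<le> 1/2"
  shows "\<exists>E\<in>sets (reward_space n D). 1 - \<delta> \<le> measure (reward_space n D) E \<and>
    (\<forall>w\<in>E. \<forall>r\<le>Q. \<forall>i<n. \<bar>estimate (budget n \<delta>) w r i - mean (D i)\<bar> \<le> (1/2)^r)"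
proof -
  interpret prob_space "reward_space n D" by (rule prob_space_reward_space)
  define bad where "bad = (\<lambda>(r, i). {w\<in>space (reward_space n D).
    \<bar>estimate (budget n \<delta>) w r i - mean (D i)\<bar> \<ge> (1/2)^r})"
  define Bad where "Bad = (\<Union>ri\<in>{..Q} \<times> {..<n}. bad ri)"
  have meas: "bad ri \<in> events" for ri
    unfolding bad_def estimate_def by (cases ri) simp
  then have Bad: "Bad \<in> events" unfolding Bad_def by auto
  have "prob Bad \<le> (\<Sum>ri\<in>{..Q} \<times> {..<n}. prob (bad ri))"
    unfolding Bad_def using meas by (intro finite_measure_subadditive_finite) auto
  also have "\<dots> = (\<Sum>r\<le>Q. \<Sum>i<n. prob (bad (r, i)))"
    by (simp add: sum.cartesian_product)
  also have "\<dots> \<le> (\<Sum>r\<le>Q. \<Sum>i<n. \<delta> / real n * (1 / ((real r + 1) * (real r + 2))))"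
    unfolding bad_def prod.case by (intro sum_mono budget_deviation n \<delta>) auto
  also have "\<dots> = \<delta> * (\<Sum>r\<le>Q. 1 / ((real r + 1) * (real r + 2)))"
    using n by (simp add: sum_distrib_left)
  also have "(\<Sum>r\<le>Q. 1 / ((real r + 1) * (real r + 2))) = 1 - 1 / (real Q + 2)"
    by (rule sum_reciprocal_telescope)
  also have "\<delta> * (1 - 1 / (real Q + 2)) \<le> \<delta>" using \<delta> by (simp add: mult_le_cancel_left1)
  finally have "prob Bad \<le> \<delta>" .
  then have "1 - \<delta> \<le> prob (space (reward_space n D) - Bad)"
    using prob_compl[OF Bad] by simp
  moreover have "\<bar>estimate (budget n \<delta>) w r i - mean (D i)\<bar> \<le> (1/2)^r"
    if "w \<in> space (reward_space n D) - Bad" "r \<le> Q" "i < n" for w r i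
    using that by (force simp: Bad_def bad_def)
  ultimately show ?thesis
    using Bad by (intro bexI[of _ "space (reward_space n D) - Bad"]) auto
qed

end

section \<open>Assembling the guarantee\<close>

theorem theorem2p1:
  shows "\<exists>C::real. C > 0 \<and> (\<exists>A::algorithm.
    \<forall>(n::nat) (K::nat) (\<epsilon>::real) (\<delta>::real) (D::nat \<Rightarrow> real measure) (\<sigma>::nat \<Rightarrow> nat).
      2 \<le> n \<and> 1 \<le> K \<and> K \<le> n - 1 \<and> 0 < \<epsilon> \<and> \<epsilon> \<le> 1 \<and> 0 < \<delta> \<and> \<delta> \<le> 1/2 \<and>
      (\<forall>i<n. prob_space (D i) \<and> sets (D i) = sets borel \<and> (AE x in D i. 0 \<le> x \<and> x \<le> 1)) \<and>
      bij_betw \<sigma> {1..n} {..<n} \<and>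
      (\<forall>i j. 1 \<le> i \<and> i \<le> j \<and> j \<le> n \<longrightarrow> mean (D (\<sigma> j)) \<le> mean (D (\<sigma> i)))
      \<longrightarrow>
      (let th = (\<lambda>i. mean (D i));
           ths = (\<lambda>k. mean (D (\<sigma> k)));
           N = nat \<lfloor>pull_bound C n ths K \<epsilon> \<delta>\<rfloor>;
           good = {(c, w). \<exists>S. exec (A n K \<epsilon> \<delta> c) n w N [] = Some S \<and> eps_topK n ths th K \<epsilon> S}
       in \<exists>E \<in> sets (run_space n D). E \<subseteq> good \<and> measure (run_space n D) E \<ge> 1 - \<delta>))"
proof (intro exI[of _ "16384::real"] conjI exI[of _ "\<lambda>n K \<epsilon> \<delta> c. phase_algorithm (budget n \<delta>) n K \<epsilon>"]
    allI impI, goal_cases)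
  case (2 n K \<epsilon> \<delta> D \<sigma>)
  then have n: "2 \<le> n" and K: "1 \<le> K" "K < n" and \<epsilon>: "0 < \<epsilon>" "\<epsilon> \<le> 1" and \<delta>: "0 < \<delta>" "\<delta> \<le> 1/2"
    and D: "\<And>i. i < n \<Longrightarrow> prob_space (D i)" "\<And>i. i < n \<Longrightarrow> sets (D i) = sets borel"
      "\<And>i. i < n \<Longrightarrow> AE x in D i. 0 \<le> x \<and> x \<le> 1"
    and \<sigma>: "bij_betw \<sigma> {1..n} {..<n}"
    and sorted: "\<And>i j. 1 \<le> i \<Longrightarrow> i \<le> j \<Longrightarrow> j \<le> n \<Longrightarrow> mean (D (\<sigma> j)) \<le> mean (D (\<sigma> i))"
    by auto
  define m where "m = budget n \<delta>"
  define N where "N = nat \<lfloor>pull_bound 16384 n (\<lambda>k. mean (D (\<sigma> k))) K \<epsilon> \<delta>\<rfloor>"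
  interpret sorted_arms n K "\<lambda>i. mean (D i)" \<sigma>
    using K \<sigma> sorted mean_bounds[of n D] D by unfold_locales auto
  \<comment> \<open>At most \<open>K\<close> slots are open, so phase \<open>Q\<close> meets the
    stopping rule on every tape and one horizon serves all \<open>w\<close>.\<close>
  obtain Q where Q: "(1/2)^Q < \<epsilon> / 2"
    using real_arch_pow_inv[of "\<epsilon> / 2" "1/2"] \<epsilon> by auto
  have "\<exists>E\<in>sets (reward_space n D). 1 - \<delta> \<le> measure (reward_space n D) E \<and>
      (\<forall>w\<in>E. \<forall>r\<le>Q. \<forall>i<n. \<bar>estimate m w r i - mean (D i)\<bar> \<le> (1/2)^r)"
    unfolding m_def by (rule prob_accurate) (use D n \<delta> in auto)
  then obtain E where E: "E \<in> sets (reward_space n D)" "1 - \<delta> \<le> measure (reward_space n D) E"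
    "\<forall>w\<in>E. \<forall>r\<le>Q. \<forall>i<n. \<bar>estimate m w r i - mean (D i)\<bar> \<le> (1/2)^r"
    by (elim bexE conjE)
  have good: "\<exists>S. exec (phase_algorithm m n K \<epsilon>) n w N [] = Some S \<and> eps_topK n ths (\<lambda>i. mean (D i)) K \<epsilon> S"
    if w: "w \<in> E" for w
  proof -
    define e where "e = estimate m w"
    interpret accurate_estimates n K "\<lambda>i. mean (D i)" \<sigma> e Q
      using E(3) w by unfold_locales (simp add: e_def)
    have "2 * (1/2)^Q * real (open_slots n K e Q) \<le> \<epsilon> * real K"
      using Q \<epsilon> by (intro mult_mono) (auto simp: open_slots_def)
    then have "final_phase n K \<epsilon> e Q" by (simp add: final_phase_def mult.commute)
    define R where "R = (LEAST r. final_phase n K \<epsilon> e r)"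
    have R: "final_phase n K \<epsilon> e R" "R \<le> Q" "\<And>r. r < R \<Longrightarrow> \<not> final_phase n K \<epsilon> e r"
      unfolding R_def using \<open>final_phase n K \<epsilon> e Q\<close>
      by (auto intro: LeastI Least_le dest: not_less_Least)
    define d where "d = Delta_eps ths K \<epsilon>"
    define W where "W = ln (ln (4 / d)) + ln (real n) + ln (1 / \<delta>)"
    define b where "b = (\<lambda>k. 16384 * W * min_inv_sq (gap ths K k) d)"
    \<comment> \<open>\<open>b\<close> is indexed by rank, as in the pull bound, whereas a run
      counts pulls per arm; the inverse of \<open>\<sigma>\<close> converts.\<close>
    define B where "B = (\<lambda>i. nat \<lfloor>b (the_inv_into {1..n} \<sigma> i)\<rfloor>)"
    have B\<sigma>: "B (\<sigma> k) = nat \<lfloor>b k\<rfloor>" if "k \<in> {1..n}" for k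
      using that inj by (simp add: B_def the_inv_into_f_f)
    have "m r \<le> B i" if r: "r \<le> R" and i: "i \<in> active n K e r" for r i
    proof -
      obtain k where k: "1 \<le> k" "k \<le> n" "i = \<sigma> k" using rank_ex[OF U_less[OF i]] by blast
      have "max (gap ths K k) d \<le> 32 * (1/2)^r"
        unfolding d_def using i k by (intro active_precision[OF \<epsilon> R(2,3) r]) auto
      then have "real (m r) \<le> b k"
        unfolding m_def b_def W_def
        using n \<delta> Delta_eps_bounds[OF \<epsilon>] gap_bounds[OF k(1,2)]
        by (intro budget_le) (auto simp: d_def)
      then show ?thesis using B\<sigma>[of k] k by (simp add: le_nat_floor)
    qed
    moreover have "(\<Sum>i<n. B i - pulls_of i []) \<le> N"
    proof -
      have b0: "0 \<le> b k" if "k \<in> {1..n}" for k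
      proof -
        \<comment> \<open>Nonnegativity of \<open>b k\<close> is read off from the budget of phase
          0, where the precision demand is trivial as the gap and \<open>d\<close> are at most
          1.\<close>
        have "max (gap ths K k) d \<le> 32 * (1/2)^0"
          using gap_bounds[of k] that Delta_eps_bounds[OF \<epsilon>] by (auto simp: d_def)
        then have "real (budget n \<delta> 0) \<le> b k"
          unfolding b_def W_def using n \<delta> Delta_eps_bounds[OF \<epsilon>] gap_bounds[of k] that
          by (intro budget_le) (auto simp: d_def)
        then show ?thesis by linarith
      qed
      have "(\<Sum>i<n. B i) = (\<Sum>k=1..n. B (\<sigma> k))"
        by (rule sum.reindex_bij_betw[OF \<sigma>, symmetric])
      then have "real (\<Sum>i<n. B i) = (\<Sum>k=1..n. real (nat \<lfloor>b k\<rfloor>))"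
        by (simp add: B\<sigma>)
      also have "\<dots> \<le> (\<Sum>k=1..n. b k)"
        using b0 by (intro sum_mono of_nat_floor) auto
      also have "\<dots> = pull_bound 16384 n ths K \<epsilon> \<delta>"
        by (simp add: pull_bound_def b_def W_def d_def sum_distrib_left)
      finally show ?thesis by (simp add: N_def le_nat_floor)
    qed
    ultimately have "exec (phase_algorithm m n K \<epsilon>) n w N [] = Some (selection n K e R)"
      unfolding e_def using R by (intro exec_phase_algorithm) (auto simp: e_def)
    then show ?thesis using selection_eps_topK[OF R(2,1)] by blast
  qed
  interpret rew: prob_space "reward_space n D" using D by (rule prob_space_reward_space)
  interpret coin: prob_space coin_space
    unfolding coin_space_def by (intro prob_space_PiM measure_pmf.prob_space_axioms)
  \<comment> \<open>The algorithm ignores its coins, so \<open>E\<close> is paired with every coin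
    tape; this rectangle is a measurable subset of the good runs.\<close>
  let ?F = "space coin_space \<times> E"
  have "emeasure (run_space n D) ?F = emeasure (reward_space n D) E"
    unfolding run_space_def using E(1)
    by (subst rew.emeasure_pair_measure_Times) (auto simp: coin.emeasure_space_1)
  then have "measure (run_space n D) ?F = measure (reward_space n D) E"
    by (simp add: measure_def)
  moreover have "?F \<in> sets (run_space n D)"
    unfolding run_space_def using E(1) by (intro pair_measureI) auto
  ultimately show ?case
    unfolding Let_def N_def[symmetric] m_def[symmetric] using E(2) good
    by (intro bexI[of _ ?F]) auto
qed simp

end
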